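(* Let $p$ be a prime number, and let $r$ be a positive integer and $n$ a nonnegative integer such that $p^{n-1}<r\le p^n$. Then the composition $c(r,s,p)$, viewed as a function of the integer $s\ge r$, is periodic in $s$, and its smallest period has length $p^n$. That is, $c(r,s+p^n,p)=c(r,s,p)$ for every integer $s\ge r$, and no positive integer $P<p^n$ satisfies $c(r,s+P,p)=c(r,s,p)$ for every integer $s\ge r$.
   Context: Let $p$ be a prime and $F$ a field of characteristic $p$. For a positive integer $m$, $J_m$ denotes the full $m\times m$ Jordan block matrix over $F$ with eigenvalue $1$. For positive integers $r\le s$, the Jordan canonical form of the $rs\times rs$ matrix $J_r\otimes J_s$ (Kronecker product) is $J_{\lambda_1}\oplus J_{\lambda_2}\oplus\cdots\oplus J_{\lambda_r}$ with exactly $r$ blocks, where $\lambda_1\ge\lambda_2\ge\cdots\ge\lambda_r>0$. The resulting partition $\lambda(r,s,p)=(\lambda_1,\dots,\lambda_r)$ of $rs$ is called the Jordan partition; it depends only on $r$, $s$ and $p$. Write $$\lambda(r,s,p)=(\overbrace{\mu_1,\dots,\mu_1}^{m_1},\overbrace{\mu_2,\dots,\mu_2}^{m_2},\dots,\overbrace{\mu_k,\dots,\mu_k}^{m_k}),\qquad \mu_1>\mu_2>\cdots>\mu_k>0,$$ with each $m_i\ge 1$. Then $c(r,s,p)$ denotes the composition $(m_1,\dots,m_k)$ of $r$, i.e. the finite sequence of multiplicities of the distinct Jordan block sizes, listed in order of decreasing block size. Two compositions are equal if they are equal as finite sequences. *)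

theory Defs
  imports
    "Jordan_Normal_Form.Jordan_Normal_Form_Existence"
    "Jordan_Normal_Form.Jordan_Normal_Form_Uniqueness"
begin

definition kronecker_mat :: "'a :: semiring_0 mat \<Rightarrow> 'a mat \<Rightarrow> 'a mat" where
  "kronecker_mat A B =
     mat (dim_row A * dim_row B) (dim_col A * dim_col B)
       (\<lambda>(i, j). A $$ (i div dim_row B, j div dim_col B) * B $$ (i mod dim_row B, j mod dim_col B))"

text \<open>The ground field enters as a type argument. That all parts are positive is contained in
  \<^const>\<open>jordan_nf\<close>, which excludes blocks of size \<open>0\<close>.\<close>

definition is_jordan_partition :: "'a :: field itself \<Rightarrow> nat \<Rightarrow> nat \<Rightarrow> nat list \<Rightarrow> bool" where
  "is_jordan_partition F r s l \<longleftrightarrow>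
     sorted_wrt (\<ge>) l \<and>
     jordan_nf (kronecker_mat (jordan_block r (1 :: 'a)) (jordan_block s 1)) (map (\<lambda>m. (m, 1)) l)"

definition jordan_partition :: "'a :: field itself \<Rightarrow> nat \<Rightarrow> nat \<Rightarrow> nat list" where
  "jordan_partition F r s = (THE l. is_jordan_partition F r s l)"

definition jordan_composition :: "'a :: field itself \<Rightarrow> nat \<Rightarrow> nat \<Rightarrow> nat list" where
  "jordan_composition F r s =
     (let l = jordan_partition F r s
      in map (count_list l) (rev (sorted_list_of_set (set l))))"

text \<open>The Jordan partition exists and is unique, so the definite description denotes it.\<close>

lemma upper_triangular_kronecker_jordan_block:
  "upper_triangular (kronecker_mat (jordan_block r (1 :: 'a :: field)) (jordan_block s 1))"
proof (intro upper_triangularI)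
  fix i j
  let ?K = "kronecker_mat (jordan_block r (1 :: 'a)) (jordan_block s 1)"
  assume ji: "j < i" and "i < dim_row ?K"
  then have i: "i < r * s" by (simp add: kronecker_mat_def)
  then have s: "s > 0" by (cases s) auto
  have lt: "i div s < r" "j div s < r" "i mod s < s" "j mod s < s"
    using i ji s by (auto simp: less_mult_imp_div_less)
  show "?K $$ (i, j) = 0"
  proof (cases "j div s = i div s")
    case True
    then have "j mod s < i mod s"
      using ji by (metis div_mult_mod_eq add_less_cancel_left)
    then show ?thesis using i ji lt by (simp add: kronecker_mat_def)
  next
    case False
    then have "j div s < i div s" using ji by (meson div_le_mono le_neq_implies_less less_imp_le)
    then show ?thesis using i ji lt by (simp add: kronecker_mat_def)
  qed
qed

lemma kronecker_jordan_block_diag: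
  assumes "i < r * s"
  shows "kronecker_mat (jordan_block r (1 :: 'a :: field)) (jordan_block s 1) $$ (i, i) = 1"
proof -
  have "s > 0" using assms by (cases s) auto
  then show ?thesis
    using assms by (simp add: kronecker_mat_def less_mult_imp_div_less)
qed

lemma similar_mat_jordan_matrix_append_commute:
  fixes xs ys :: "(nat \<times> 'a :: field) list"
  shows "similar_mat (jordan_matrix (xs @ ys)) (jordan_matrix (ys @ xs))"
proof -
  define n m where "n = sum_list (map fst xs)" and "m = sum_list (map fst ys)"
  let ?A = "jordan_matrix xs" and ?B = "jordan_matrix ys"
  have A: "?A \<in> carrier_mat n n" and B: "?B \<in> carrier_mat m m"
    unfolding n_def m_def by auto
  have AB: "jordan_matrix (xs @ ys) = four_block_mat ?A (0\<^sub>m n m) (0\<^sub>m m n) ?B"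
    unfolding jordan_matrix_def map_append diag_block_mat_append Let_def
    by (simp flip: jordan_matrix_def add: n_def m_def)
  have BA: "jordan_matrix (ys @ xs) = four_block_mat ?B (0\<^sub>m m n) (0\<^sub>m n m) ?A"
    unfolding jordan_matrix_def map_append diag_block_mat_append Let_def
    by (simp flip: jordan_matrix_def add: n_def m_def)
  let ?P = "four_block_mat (0\<^sub>m n m) (1\<^sub>m n) (1\<^sub>m m) (0\<^sub>m m n) :: 'a mat"
  let ?Q = "four_block_mat (0\<^sub>m m n) (1\<^sub>m m) (1\<^sub>m n) (0\<^sub>m n m) :: 'a mat"
  have PQ: "?P * ?Q = 1\<^sub>m (n + m)"
    by (subst mult_four_block_mat[where ?nr1.0 = n and ?n1.0 = m and ?n2.0 = n and ?nr2.0 = m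
          and ?nc1.0 = n and ?nc2.0 = m]) auto
  have QP: "?Q * ?P = 1\<^sub>m (n + m)"
    by (subst mult_four_block_mat[where ?nr1.0 = m and ?n1.0 = n and ?n2.0 = m and ?nr2.0 = n
          and ?nc1.0 = m and ?nc2.0 = n]) (auto simp: add.commute)
  have simps: "0\<^sub>m n m * ?B = 0\<^sub>m n m" "1\<^sub>m n * ?A = ?A" "1\<^sub>m m * ?B = ?B"
    "0\<^sub>m m n * ?A = 0\<^sub>m m n" "0\<^sub>m n n + ?A = ?A" "?B + 0\<^sub>m m m = ?B"
    "?A * 1\<^sub>m n = ?A" "?A * 0\<^sub>m n m = 0\<^sub>m n m" "?B * 0\<^sub>m m n = 0\<^sub>m m n" "?B * 1\<^sub>m m = ?B"
    using left_mult_zero_mat[OF B] left_mult_one_mat[OF A] left_mult_one_mat[OF B]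
      left_mult_zero_mat[OF A] left_add_zero_mat[OF A] right_add_zero_mat[OF B]
      right_mult_one_mat[OF A] right_mult_zero_mat[OF A] right_mult_zero_mat[OF B]
      right_mult_one_mat[OF B] by auto
  have "?P * jordan_matrix (ys @ xs) = four_block_mat (0\<^sub>m n m) ?A ?B (0\<^sub>m m n)"
    unfolding BA using A B
    by (subst mult_four_block_mat[where ?nr1.0 = n and ?n1.0 = m and ?n2.0 = n and ?nr2.0 = m
          and ?nc1.0 = m and ?nc2.0 = n]) (auto simp: simps)
  then have "?P * jordan_matrix (ys @ xs) * ?Q = jordan_matrix (xs @ ys)"
    unfolding AB using A B
    by (simp, subst mult_four_block_mat[where ?nr1.0 = n and ?n1.0 = m and ?n2.0 = n and ?nr2.0 = m
          and ?nc1.0 = n and ?nc2.0 = m]) (auto simp: simps)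
  moreover have "jordan_matrix (xs @ ys) \<in> carrier_mat (n + m) (n + m)"
    using A B unfolding AB by auto
  moreover have "jordan_matrix (ys @ xs) \<in> carrier_mat (n + m) (n + m)"
    using A B unfolding BA by (auto simp: add.commute)
  moreover have "?P \<in> carrier_mat (n + m) (n + m)" "?Q \<in> carrier_mat (n + m) (n + m)"
    by (intro carrier_matI; simp)+
  ultimately show ?thesis
    by (intro similar_matI[of _ _ ?P ?Q "n + m"] PQ QP) (simp_all only: insert_subset empty_subsetI simp_thms)
qed

lemma similar_mat_jordan_matrix_append_cong:
  assumes "similar_mat (jordan_matrix xs) (jordan_matrix xs')"
    and "similar_mat (jordan_matrix ys) (jordan_matrix ys')"
  shows "similar_mat (jordan_matrix (xs @ ys)) (jordan_matrix (xs' @ ys'))"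
proof -
  have "similar_mat (diag_block_mat [jordan_matrix xs, jordan_matrix ys])
      (diag_block_mat [jordan_matrix xs', jordan_matrix ys'])"
    using similar_diag_mat_block_mat[of "[(jordan_matrix xs, jordan_matrix xs'),
        (jordan_matrix ys, jordan_matrix ys')]"] assms by auto
  then show ?thesis
    using jordan_matrix_concat_diag_block_mat[of "[xs, ys]"]
      jordan_matrix_concat_diag_block_mat[of "[xs', ys']"] by simp
qed

lemma similar_mat_jordan_matrix_mset_cong:
  fixes xs ys :: "(nat \<times> 'a :: field) list"
  assumes "mset xs = mset ys"
  shows "similar_mat (jordan_matrix xs) (jordan_matrix ys)"
  using assms
proof (induction xs arbitrary: ys)
  case Nil
  then show ?case using similar_mat_refl[OF jordan_matrix_carrier] by simp
next
  case (Cons x xs)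
  note refl = similar_mat_refl[OF jordan_matrix_carrier]
  have "x \<in> set ys" using Cons.prems by (metis list.set_intros(1) set_mset_mset)
  then obtain us vs where ys: "ys = us @ x # vs" by (meson split_list)
  then have "similar_mat (jordan_matrix xs) (jordan_matrix (us @ vs))"
    using Cons by simp
  then have "similar_mat (jordan_matrix ([x] @ xs)) (jordan_matrix ([x] @ (us @ vs)))"
    by (intro similar_mat_jordan_matrix_append_cong refl)
  moreover have "similar_mat (jordan_matrix (([x] @ us) @ vs)) (jordan_matrix ((us @ [x]) @ vs))"
    by (intro similar_mat_jordan_matrix_append_cong similar_mat_jordan_matrix_append_commute refl)
  ultimately show ?case
    using similar_mat_trans[of "jordan_matrix (x # xs)" "jordan_matrix (x # us @ vs)"]
    by (simp add: ys)
qed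

lemma jordan_nf_mset_cong:
  fixes A :: "'a :: field mat"
  assumes "jordan_nf A xs" and "mset xs = mset ys"
  shows "jordan_nf A ys"
  using assms(1) similar_mat_jordan_matrix_mset_cong[OF assms(2)] mset_eq_setD[OF assms(2)]
    similar_mat_trans[of A "jordan_matrix xs" "jordan_matrix ys"]
  unfolding jordan_nf_def by simp

lemma is_jordan_partition_ex1: "\<exists>!l. is_jordan_partition TYPE('a :: field) r s l"
proof -
  let ?K = "kronecker_mat (jordan_block r (1 :: 'a)) (jordan_block s 1)"
  have K: "?K \<in> carrier_mat (r * s) (r * s)"
    by (simp add: kronecker_mat_def)
  have "upper_triangular ?K" by (rule upper_triangular_kronecker_jordan_block)
  from triangular_to_jnf_vector[OF K this] obtain n_as where jnf: "jordan_nf ?K n_as" ..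
  have ev: "a = 1" if "(n, a) \<in> set n_as" for n a
  proof -
    have "n \<noteq> 0" using jnf that unfolding jordan_nf_def by force
    then have "poly (char_poly ?K) a = 0"
      using jordan_nf_block_size_order_bound[OF jnf that] order_root[of "char_poly ?K" a] by simp
    moreover have "char_poly ?K = (\<Prod>a\<leftarrow>diag_mat ?K. [:- a, 1:])"
      by (rule char_poly_upper_triangular[OF K upper_triangular_kronecker_jordan_block])
    ultimately have "a \<in> set (diag_mat ?K)"
      using linear_poly_root by (auto simp: poly_prod_list prod_list_zero_iff)
    then show "a = 1"
      using K kronecker_jordan_block_diag by (auto simp: diag_mat_def)
  qed
  define l where "l = rev (sort (map fst n_as))"
  have "mset n_as = mset (map (\<lambda>m. (m, 1)) l)"
  proof -
    have "map (\<lambda>m. (m, 1)) (map fst n_as) = n_as"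
      using ev by (force intro: map_idI simp: comp_def)
    moreover have "mset (map (\<lambda>m. (m, 1 :: 'a)) l) = mset (map (\<lambda>m. (m, 1)) (map fst n_as))"
      by (simp only: l_def mset_map mset_rev mset_sort)
    ultimately show ?thesis by simp
  qed
  then have "jordan_nf ?K (map (\<lambda>m. (m, 1)) l)"
    using jnf by (rule jordan_nf_mset_cong[rotated])
  moreover have "sorted_wrt (\<ge>) l"
    by (simp add: l_def sorted_wrt_rev)
  ultimately have ex: "is_jordan_partition TYPE('a) r s l"
    by (simp add: is_jordan_partition_def)
  have count: "count_list x k = compute_nr_of_jordan_blocks ?K 1 k"
    if "is_jordan_partition TYPE('a) r s x" "k \<noteq> 0" for x k
  proof -
    have "length (filter ((=) (k, 1)) (map (\<lambda>m. (m, 1 :: 'a)) x)) = count_list x k"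
      by (induction x) auto
    then show ?thesis
      using compute_nr_of_jordan_blocks[OF _ that(2), of ?K "map (\<lambda>m. (m, 1)) x" 1] that(1)
      by (simp add: is_jordan_partition_def)
  qed
  have uniq: "x = y" if x: "is_jordan_partition TYPE('a) r s x"
    and y: "is_jordan_partition TYPE('a) r s y" for x y
  proof -
    have "count_list x k = count_list y k" for k
    proof (cases "k = 0")
      case True
      have "0 \<notin> set x" "0 \<notin> set y"
        using x y by (force simp: is_jordan_partition_def jordan_nf_def)+
      then show ?thesis using True by (simp add: count_list_0_iff)
    qed (simp add: count[OF x] count[OF y])
    then have "mset (rev x) = mset (rev y)"
      by (intro multiset_eqI) (simp add: count_mset)
    moreover have "sorted (rev x)" "sorted (rev y)"
      using x y by (simp_all add: is_jordan_partition_def sorted_wrt_rev)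
    ultimately have "rev x = rev y"
      by (metis properties_for_sort)
    then show ?thesis by simp
  qed
  show ?thesis using ex uniq by blast
qed

end

theory Submission
  imports Defs "HOL-Computational_Algebra.Formal_Power_Series"
begin

text \<open>
  Write \<open>K = J\<^sub>r \<otimes> J\<^sub>s\<close> and \<open>N = K - 1\<close>. On the algebra \<open>M\<^sub>s = F[X, Y] / (X\<^sup>r, Y\<^sup>s)\<close> the nilpotent
  matrix \<open>N\<close> acts as multiplication by \<open>T = (1 + X) (1 + Y) - 1 = X + Y + X Y\<close>. Let \<open>Q = p ^ n\<close> with
  \<open>r \<le> Q\<close>. In characteristic \<open>p\<close> one has \<open>T ^ Q = X ^ Q + Y ^ Q + X ^ Q Y ^ Q\<close>, and since
  \<open>X\<^sup>r = 0\<close> this is just \<open>Y ^ Q\<close>. So \<open>T ^ Q\<close> maps \<open>M\<^bsub>s + Q\<^esub>\<close> onto a copy of \<open>M\<^sub>s\<close>, with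
  kernel of dimension \<open>r Q\<close>; therefore the nullity of \<open>N ^ (k + Q)\<close> for \<open>s + Q\<close> exceeds the nullity of
  \<open>N ^ k\<close> for \<open>s\<close> by exactly \<open>r Q\<close> (\<open>kernel_dim_kron_nilp_shift\<close>). For \<open>r \<le> s\<close> the
  nullity of \<open>N\<close> is \<open>r\<close> (\<open>kernel_dim_kron_nilp\<close>), so there are exactly \<open>r\<close> Jordan blocks. The
  nullities of the powers of \<open>N\<close> determine the block sizes, and together these two facts say that
  passing from \<open>s\<close> to \<open>s + Q\<close> enlarges every block by \<open>Q\<close> (\<open>jordan_partition_shift\<close>). The
  multiplicities do not change: \<open>Q\<close> is a period.

  For minimality, suppose a positive \<open>P < Q\<close> is a period. Then so is \<open>gcd P Q\<close>, a proper divisor of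
  \<open>p ^ n\<close>, hence so is \<open>q = p ^ (n - 1)\<close>, which is smaller than \<open>r\<close>. For \<open>s = Q\<close> all \<open>r\<close> blocks have size \<open>Q\<close>
  (\<open>jordan_partition_prime_power\<close>). If also for \<open>s = Q + q\<close> all \<open>r\<close> blocks had the same size, this size
  would be \<open>Q + q\<close>, and \<open>T ^ (Q + q)\<close> would vanish on \<open>M\<^bsub>Q + q\<^esub>\<close>; equivalently \<open>T ^ q\<close>
  would vanish modulo \<open>(X\<^sup>r, Y ^ q)\<close>. But \<open>T ^ q\<close> contains the monomial \<open>X ^ q\<close> and \<open>q < r\<close>.
\<close>

section \<open>Dimensions of matrix kernels\<close>

text \<open>Linearity of \<open>f\<close> is demanded on all vectors rather than on the kernel only: below \<open>f\<close>
  always selects coordinates.\<close>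

lemma kernel_dim_eqI:
  fixes A B :: "'a :: field mat"
  assumes A: "A \<in> carrier_mat nr n" and B: "B \<in> carrier_mat nr' m"
    and bij: "bij_betw f (mat_kernel A) (mat_kernel B)"
    and add: "\<And>u v. u \<in> carrier_vec n \<Longrightarrow> v \<in> carrier_vec n \<Longrightarrow> f (u + v) = f u + f v"
    and smult: "\<And>c v. v \<in> carrier_vec n \<Longrightarrow> f (c \<cdot>\<^sub>v v) = c \<cdot>\<^sub>v f v"
  shows "kernel_dim A = kernel_dim B"
proof -
  interpret KA: kernel nr n A by unfold_locales (rule A)
  interpret KB: kernel nr' m B by unfold_locales (rule B)
  have sub: "mat_kernel A \<subseteq> carrier_vec n"
    using mat_kernel_carrier[OF A] .
  interpret L: linear_map class_ring KA.VK KB.VK f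
    apply (intro linear_map.intro mod_hom.intro mod_hom_axioms.intro)
    apply (rule KA.Ker.vectorspace_axioms KB.Ker.vectorspace_axioms KA.Ker.module_axioms KB.Ker.module_axioms)+
    using bij sub by (auto simp: module_hom_def bij_betw_def add smult module_vec_simps subset_iff)
  have "KA.Ker.fin_dim"
    using kernel_basis_exists[OF A] unfolding KA.Ker.fin_dim_def KA.Ker.basis_def by auto
  then have "KA.dim = KB.dim"
    by (rule L.dim_eq) (use bij in \<open>auto simp: bij_betw_def\<close>)
  then show ?thesis by simp
qed

text \<open>A basis of the kernel with \<open>n\<close> elements is an independent set of full size in
  \<open>F\<^sup>n\<close>, hence spans everything.\<close>

lemma mat_kernel_eq_carrier_vec:
  fixes A :: "'a :: field mat"
  assumes A: "A \<in> carrier_mat nr n" and dim: "kernel_dim A = n"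
  shows "mat_kernel A = carrier_vec n"
proof -
  interpret kernel nr n A by unfold_locales (rule A)
  obtain S where fin: "finite S" and S: "basis S"
    using kernel_basis_exists[OF A] by blast
  then have sub: "S \<subseteq> mat_kernel A" and li: "lin_indpt S" and span: "span S = mat_kernel A"
    by (auto simp: Ker.basis_def)
  have carr: "S \<subseteq> carrier_vec n" using sub mat_kernel_carrier[OF A] by blast
  have "card S = NC.dim"
    using Ker.dim_basis[OF fin S] dim by (simp add: NC.dim_is_n)
  then have "NC.basis S"
    using li lindep_same[OF sub] carr fin by (intro NC.dim_li_is_basis) auto
  then have "NC.span S = carrier_vec n" by (auto simp: NC.basis_def)
  then show ?thesis using span span_same[OF sub] by simp
qed

lemma kernel_dim_zero_mat: "kernel_dim (0\<^sub>m nr n :: 'a :: field mat) = n"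
proof -
  interpret kernel nr n "0\<^sub>m nr n :: 'a mat" by unfold_locales simp
  have "mat_kernel (0\<^sub>m nr n :: 'a mat) = carrier_vec n"
    by (auto simp: mat_kernel[of _ nr n])
  then have "VK = NC.V" by simp
  then show ?thesis by (simp add: NC.dim_is_n)
qed

text \<open>After permuting the coordinates by \<open>\<pi>\<close>, the equations \<open>A v = 0\<close> become \<open>B w = 0\<close> for the
  first \<open>n\<close> coordinates \<open>w\<close> and leave the other \<open>m\<close> coordinates free; so the kernel of \<open>A\<close> is that of
  the block diagonal matrix with blocks \<open>B\<close> and \<open>0\<close>.\<close>

lemma kernel_dim_reindex:
  fixes A B :: "'a :: field mat"
  assumes A: "A \<in> carrier_mat (n + m) (n + m)" and B: "B \<in> carrier_mat n n"
    and \<pi>: "bij_betw \<pi> {..<n + m} {..<n + m}"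
    and iff: "\<And>v. v \<in> carrier_vec (n + m) \<Longrightarrow>
      A *\<^sub>v v = 0\<^sub>v (n + m) \<longleftrightarrow> B *\<^sub>v vec n (\<lambda>i. v $ \<pi> i) = 0\<^sub>v n"
  shows "kernel_dim A = kernel_dim B + m"
proof -
  let ?D = "0\<^sub>m m m :: 'a mat"
  let ?C = "four_block_mat B (0\<^sub>m n m) (0\<^sub>m m n) ?D"
  have C: "?C \<in> carrier_mat (n + m) (n + m)" using B by auto
  define f where "f v = vec (n + m) (\<lambda>i. v $ \<pi> i)" for v :: "'a vec"
  define \<sigma> where "\<sigma> = the_inv_into {..<n + m} \<pi>"
  define g where "g v = vec (n + m) (\<lambda>i. v $ \<sigma> i)" for v :: "'a vec"
  have \<pi>_less: "\<pi> i < n + m" if "i < n + m" for i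
    using \<pi> that by (auto simp: bij_betw_def)
  have \<sigma>: "bij_betw \<sigma> {..<n + m} {..<n + m}"
    unfolding \<sigma>_def by (rule bij_betw_the_inv_into[OF \<pi>])
  have \<sigma>_less: "\<sigma> i < n + m" if "i < n + m" for i
    using \<sigma> that by (auto simp: bij_betw_def)
  have \<sigma>\<pi>: "\<sigma> (\<pi> i) = i" if "i < n + m" for i
    unfolding \<sigma>_def using \<pi> that by (intro the_inv_into_f_f) (auto simp: bij_betw_def)
  have \<pi>\<sigma>: "\<pi> (\<sigma> i) = i" if "i < n + m" for i
    unfolding \<sigma>_def using \<pi> that by (intro f_the_inv_into_f) (auto simp: bij_betw_def)
  have kerC: "w \<in> mat_kernel ?C \<longleftrightarrow> B *\<^sub>v vec n (\<lambda>i. w $ i) = 0\<^sub>v n" if w: "w \<in> carrier_vec (n + m)" for w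
  proof -
    define w1 w2 where "w1 = vec n (\<lambda>i. w $ i)" and "w2 = vec m (\<lambda>i. w $ (n + i))"
    have w12: "w = w1 @\<^sub>v w2" "w1 \<in> carrier_vec n" "w2 \<in> carrier_vec m"
      using w by (auto simp: w1_def w2_def intro!: eq_vecI)
    have "?C *\<^sub>v w = (B *\<^sub>v w1) @\<^sub>v 0\<^sub>v m"
      unfolding w12(1) using B w12
      by (subst four_block_mat_mult_vec[OF B _ _ _ w12(2,3)]) auto
    moreover have "0\<^sub>v (n + m) = 0\<^sub>v n @\<^sub>v (0\<^sub>v m :: 'a vec)" by auto
    ultimately have "?C *\<^sub>v w = 0\<^sub>v (n + m) \<longleftrightarrow> B *\<^sub>v w1 = 0\<^sub>v n"
      using append_vec_eq[of "B *\<^sub>v w1" n "0\<^sub>v n" "0\<^sub>v m" "0\<^sub>v m"] B w12 by auto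
    then show ?thesis using w by (simp add: mat_kernel[OF C] w1_def)
  qed
  have f_iff: "f v \<in> mat_kernel ?C \<longleftrightarrow> v \<in> mat_kernel A" if "v \<in> carrier_vec (n + m)" for v
  proof -
    have "vec n (\<lambda>i. f v $ i) = vec n (\<lambda>i. v $ \<pi> i)" by (auto simp: f_def)
    then show ?thesis
      using iff[OF that] that by (subst kerC) (auto simp: f_def mat_kernel[OF A])
  qed
  have fg: "f (g v) = v" and gf: "g (f v) = v" if "v \<in> carrier_vec (n + m)" for v
    using that \<pi>_less \<sigma>_less \<sigma>\<pi> \<pi>\<sigma> by (auto simp: f_def g_def)
  have "bij_betw f (mat_kernel A) (mat_kernel ?C)"
  proof (rule bij_betw_byWitness[of _ g])
    have g: "g w \<in> carrier_vec (n + m)" for w by (simp add: g_def)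
    show "g ` mat_kernel ?C \<subseteq> mat_kernel A"
    proof
      fix v assume "v \<in> g ` mat_kernel ?C"
      then obtain w where w: "w \<in> mat_kernel ?C" "v = g w" by blast
      then have "f v = w" using fg mat_kernel_carrier[OF C] by blast
      then show "v \<in> mat_kernel A" using f_iff[of v] w g by simp
    qed
  qed (use fg gf f_iff mat_kernel_carrier[OF A] mat_kernel_carrier[OF C] in auto)
  then have "kernel_dim A = kernel_dim ?C"
    by (rule kernel_dim_eqI[OF A C]) (use \<pi>_less in \<open>auto simp: f_def\<close>)
  also have "\<dots> = kernel_dim B + m"
    using kernel_four_block_0_mat[OF refl B, of ?D m] kernel_dim_zero_mat[of m m, where ?'a = 'a] B
    by (simp add: kernel_dim_def)
  finally show ?thesis .
qed

section \<open>The unipotent Kronecker product as multiplication by X + Y + XY\<close>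

lemma sum_jordan_block_row:
  assumes "x < n"
  shows "(\<Sum>j<n. jordan_block n (1 :: 'a :: field) $$ (x, j) * g j) = g x + (if Suc x < n then g (Suc x) else 0)"
proof -
  have "(\<Sum>j<n. jordan_block n (1 :: 'a) $$ (x, j) * g j) =
      (\<Sum>j<n. (if j = x then g j else 0) + (if j = Suc x then g j else 0))"
    using assms by (intro sum.cong) auto
  also have "\<dots> = g x + (if Suc x < n then g (Suc x) else 0)"
    using assms by (simp add: sum.distrib sum.delta)
  finally show ?thesis .
qed

abbreviation kron_jordan :: "nat \<Rightarrow> nat \<Rightarrow> 'a :: field mat" where
  "kron_jordan r s \<equiv> kronecker_mat (jordan_block r 1) (jordan_block s 1)"

definition kron_nilp :: "nat \<Rightarrow> nat \<Rightarrow> 'a :: field mat" where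
  "kron_nilp r s = char_matrix (kron_jordan r s) 1"

lemma kron_nilp_carrier [simp]: "kron_nilp r s \<in> carrier_mat (r * s) (r * s)"
  unfolding kron_nilp_def by (intro char_matrix_closed) (simp add: kronecker_mat_def)

lemma pair_index_less: "x * s + y < r * s" if "x < r" "y < (s :: nat)"
proof -
  have "x * s + y < Suc x * s" using that by simp
  also have "\<dots> \<le> r * s" using that by (intro mult_le_mono1) simp
  finally show ?thesis .
qed

lemma kron_nilp_mult_vec:
  fixes v :: "'a :: field vec"
  assumes v: "v \<in> carrier_vec (r * s)" and xy: "x < r" "y < s"
  shows "(kron_nilp r s *\<^sub>v v) $ (x * s + y) =
    (if Suc x < r then v $ (Suc x * s + y) else 0) +
    (if Suc y < s then v $ (x * s + Suc y) else 0) +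
    (if Suc x < r \<and> Suc y < s then v $ (Suc x * s + Suc y) else 0)"
proof -
  let ?K = "kron_jordan r s :: 'a mat" and ?i = "x * s + y"
  have i: "?i < r * s" using xy by (rule pair_index_less)
  have K: "?K \<in> carrier_mat (r * s) (r * s)" by (simp add: kronecker_mat_def)
  have "(?K *\<^sub>v v) $ ?i = (\<Sum>j<r * s. ?K $$ (?i, j) * v $ j)"
    using K v i by (simp add: scalar_prod_def lessThan_atLeast0)
  also have "\<dots> = (\<Sum>m<r. \<Sum>j\<in>{m * s..<m * s + s}. ?K $$ (?i, j) * v $ j)"
    by (rule sum.nat_group[symmetric])
  also have "\<dots> = (\<Sum>m<r. \<Sum>j<s. ?K $$ (?i, m * s + j) * v $ (m * s + j))"
  proof (rule sum.cong[OF refl])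
    fix m
    show "(\<Sum>j\<in>{m * s..<m * s + s}. ?K $$ (?i, j) * v $ j) =
        (\<Sum>j<s. ?K $$ (?i, m * s + j) * v $ (m * s + j))"
      by (intro sum.reindex_bij_witness[of _ "\<lambda>j. m * s + j" "\<lambda>j. j - m * s"]) auto
  qed
  also have "\<dots> = (\<Sum>m<r. jordan_block r 1 $$ (x, m) *
      (\<Sum>j<s. jordan_block s 1 $$ (y, j) * v $ (m * s + j)))"
    unfolding sum_distrib_left using xy i pair_index_less[of _ r _ s]
    by (intro sum.cong refl) (simp add: kronecker_mat_def mult_ac)
  finally have Kv: "(?K *\<^sub>v v) $ ?i = \<dots>" .
  have "(kron_nilp r s *\<^sub>v v) $ ?i = (?K *\<^sub>v v) $ ?i - v $ ?i"
    using K v i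
    by (simp add: kron_nilp_def char_matrix_def add_mult_distrib_mat_vec[OF K] row_smult)
  also have "\<dots> = (if Suc x < r then v $ (Suc x * s + y) else 0) +
    (if Suc y < s then v $ (x * s + Suc y) else 0) +
    (if Suc x < r \<and> Suc y < s then v $ (Suc x * s + Suc y) else 0)"
    unfolding Kv sum_jordan_block_row[OF xy(1)] sum_jordan_block_row[OF xy(2)] by simp
  finally show ?thesis .
qed

abbreviation coeff2 :: "'a fps fps \<Rightarrow> nat \<Rightarrow> nat \<Rightarrow> 'a" where
  "coeff2 f a b \<equiv> fps_nth (fps_nth f a) b"

text \<open>The polynomial \<open>X + Y + X Y\<close>, where the outer variable \<open>fps_X\<close> is \<open>X\<close> and the inner variable
  \<open>fps_const fps_X\<close> is \<open>Y\<close>. Power series serve only as a commutative ring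
  of characteristic \<open>p\<close> with a convenient coefficient calculus; all statements are about
  finitely many coefficients.\<close>

definition T_fps :: "'a :: field fps fps" where
  "T_fps = fps_X + fps_const fps_X + fps_X * fps_const fps_X"

text \<open>The matrix entries above the diagonal move a coordinate towards smaller indices, whereas
  multiplication by \<open>X\<close> or \<open>Y\<close> raises exponents. Reversing both indices reconciles the two.\<close>

definition vec_fps :: "nat \<Rightarrow> nat \<Rightarrow> 'a :: field vec \<Rightarrow> 'a fps fps" where
  "vec_fps r s v = Abs_fps (\<lambda>a. Abs_fps (\<lambda>b.
     if a < r \<and> b < s then v $ ((r - 1 - a) * s + (s - 1 - b)) else 0))"

lemma vec_fps_nth:
  "coeff2 (vec_fps r s v) a b = (if a < r \<and> b < s then v $ ((r - 1 - a) * s + (s - 1 - b)) else 0)"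
  by (simp add: vec_fps_def)

text \<open>Congruence modulo the ideal generated by \<open>X\<^sup>r\<close> and \<open>Y\<^sup>s\<close>.\<close>

definition fps_agree :: "nat \<Rightarrow> nat \<Rightarrow> 'a :: field fps fps \<Rightarrow> 'a fps fps \<Rightarrow> bool" where
  "fps_agree r s f g \<longleftrightarrow> (\<forall>a<r. \<forall>b<s. coeff2 f a b = coeff2 g a b)"

lemma fps_agree_refl: "fps_agree r s f f"
  by (simp add: fps_agree_def)

lemma fps_agree_sym: "fps_agree r s f g \<Longrightarrow> fps_agree r s g f"
  by (simp add: fps_agree_def)

lemma fps_agree_trans: "fps_agree r s f g \<Longrightarrow> fps_agree r s g h \<Longrightarrow> fps_agree r s f h"
  by (simp add: fps_agree_def)

text \<open>A coefficient of a product involves only coefficients with smaller or equal exponents.\<close>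

lemma fps_agree_mult:
  assumes "fps_agree r s f g"
  shows "fps_agree r s (h * f) (h * g)"
  using assms unfolding fps_agree_def
  by (auto simp: fps_mult_nth fps_sum_nth intro!: sum.cong)

lemma T_fps_mult_nth:
  "coeff2 (T_fps * f) a b = (if a > 0 then coeff2 f (a - 1) b else 0) + (if b > 0 then coeff2 f a (b - 1) else 0) +
     (if a > 0 \<and> b > 0 then coeff2 f (a - 1) (b - 1) else 0)"
  by (simp add: T_fps_def distrib_right mult.assoc)

lemma vec_fps_kron_nilp:
  assumes v: "v \<in> carrier_vec (r * s)"
  shows "fps_agree r s (vec_fps r s (kron_nilp r s *\<^sub>v v)) (T_fps * vec_fps r s v)"
  unfolding fps_agree_def
proof (intro allI impI)
  fix a b assume ab: "a < r" "b < s"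
  obtain x y where "r = Suc (a + x)" "s = Suc (b + y)"
    using ab by (auto dest!: less_imp_Suc_add)
  then show "coeff2 (vec_fps r s (kron_nilp r s *\<^sub>v v)) a b = coeff2 (T_fps * vec_fps r s v) a b"
    using kron_nilp_mult_vec[OF v, of x y]
    by (cases a; cases b) (simp_all add: T_fps_mult_nth vec_fps_nth del: fps_mult_nth_0)
qed

lemma vec_fps_kron_nilp_pow:
  assumes v: "v \<in> carrier_vec (r * s)"
  shows "fps_agree r s (vec_fps r s (kron_nilp r s ^\<^sub>m k *\<^sub>v v)) (T_fps ^ k * vec_fps r s v)"
  using v
proof (induction k arbitrary: v)
  case 0
  then show ?case by (simp add: fps_agree_refl carrier_matD[OF kron_nilp_carrier])
next
  case (Suc k)
  let ?N = "kron_nilp r s :: 'a mat"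
  have Nv: "?N *\<^sub>v v \<in> carrier_vec (r * s)"
    by (rule mult_mat_vec_carrier[OF kron_nilp_carrier Suc.prems])
  have "?N ^\<^sub>m Suc k *\<^sub>v v = ?N ^\<^sub>m k *\<^sub>v (?N *\<^sub>v v)"
    using Suc.prems by (simp add: assoc_mult_mat_vec[OF pow_carrier_mat[OF kron_nilp_carrier] kron_nilp_carrier])
  moreover have "T_fps ^ Suc k * vec_fps r s v = T_fps ^ k * (T_fps * vec_fps r s v)"
    by (simp add: mult_ac)
  ultimately show ?case
    using fps_agree_trans[OF Suc.IH[OF Nv] fps_agree_mult[OF vec_fps_kron_nilp[OF Suc.prems]]] by metis
qed

lemma vec_fps_eq_0_iff:
  assumes "v \<in> carrier_vec (r * s)"
  shows "fps_agree r s (vec_fps r s v) 0 \<longleftrightarrow> v = 0\<^sub>v (r * s)"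
proof
  assume *: "fps_agree r s (vec_fps r s v) 0"
  show "v = 0\<^sub>v (r * s)"
  proof (rule eq_vecI)
    fix i assume "i < dim_vec (0\<^sub>v (r * s))"
    then have i: "i < r * s" by simp
    then have "s > 0" by (cases s) auto
    have xy: "i div s < r" "i mod s < s" using i \<open>s > 0\<close> by (auto simp: less_mult_imp_div_less)
    then have "coeff2 (vec_fps r s v) (r - 1 - i div s) (s - 1 - i mod s) = 0"
      using * by (simp add: fps_agree_def)
    then show "v $ i = 0\<^sub>v (r * s) $ i"
      using xy i by (simp add: vec_fps_nth)
  qed (use assms in auto)
next
  have idx: "(r - 1 - a) * s + (s - 1 - b) < r * s" if "a < r" "b < s" for a b
    using that by (intro pair_index_less) auto
  assume "v = 0\<^sub>v (r * s)"
  then have "v $ ((r - 1 - a) * s + (s - 1 - b)) = 0" if "a < r" "b < s" for a b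
    using idx[OF that] by simp
  then show "fps_agree r s (vec_fps r s v) 0"
    unfolding fps_agree_def vec_fps_nth by simp
qed

text \<open>The kernels of powers of \<open>N\<close> translated into the ideal of \<open>X\<^sup>r\<close> and \<open>Y\<^sup>s\<close>.\<close>

lemma kron_nilp_pow_mult_eq_0_iff:
  assumes v: "v \<in> carrier_vec (r * s)"
  shows "kron_nilp r s ^\<^sub>m k *\<^sub>v v = 0\<^sub>v (r * s) \<longleftrightarrow> fps_agree r s (T_fps ^ k * vec_fps r s v) 0"
  using vec_fps_kron_nilp_pow[OF v, of k] vec_fps_eq_0_iff[of "kron_nilp r s ^\<^sub>m k *\<^sub>v v" r s]
    mult_mat_vec_carrier[OF pow_carrier_mat[OF kron_nilp_carrier] v]
    fps_agree_sym fps_agree_trans by blast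

lemma T_fps_power_char:
  assumes "prime CHAR('a)" and "Q = CHAR('a) ^ n"
  shows "(T_fps :: 'a :: field fps fps) ^ Q = fps_X ^ Q + fps_const fps_X ^ Q + fps_X ^ Q * fps_const fps_X ^ Q"
  using freshmans_dream'[where ?'a = "'a fps fps" and m = Q and n = n] assms
  by (simp add: T_fps_def power_mult_distrib)

lemma fps_agree_Y_power_mult:
  "fps_agree r (s + Q) (fps_const fps_X ^ Q * f) 0 \<longleftrightarrow> fps_agree r s f 0"
proof -
  have "(\<forall>b<s + Q. (if b < Q then 0 else h (b - Q)) = (0 :: 'a)) \<longleftrightarrow> (\<forall>b<s. h b = 0)" for h
    by (auto simp: dest: spec[of _ "_ + Q"]) 
  then show ?thesis
    by (simp add: fps_agree_def fps_X_power_mult_nth fps_const_power)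
qed

text \<open>Modulo \<open>X\<^sup>r\<close> the factor \<open>T ^ Q\<close> is \<open>Y ^ Q\<close>, and multiplication by \<open>Y ^ Q\<close> shifts coefficients by
  \<open>Q\<close> in the direction of \<open>Y\<close>.\<close>

lemma T_fps_power_mult_agree_0_iff:
  assumes "prime CHAR('a)" and Q: "Q = CHAR('a) ^ n" and r: "r \<le> Q"
  shows "fps_agree r (s + Q) ((T_fps :: 'a :: field fps fps) ^ (k + Q) * f) 0 \<longleftrightarrow>
    fps_agree r s (T_fps ^ k * f) 0"
proof -
  let ?Y = "fps_const fps_X :: 'a fps fps"
  have "fps_agree r (s + Q) (T_fps ^ (k + Q) * f) (?Y ^ Q * (T_fps ^ k * f))"
  proof -
    have "T_fps ^ (k + Q) * f = ?Y ^ Q * (T_fps ^ k * f) + fps_X ^ Q * ((1 + ?Y ^ Q) * (T_fps ^ k * f))"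
      unfolding power_add T_fps_power_char[OF assms(1) Q] by (simp add: algebra_simps)
    then show ?thesis using r by (simp add: fps_agree_def fps_X_power_mult_nth)
  qed
  then show ?thesis
    using fps_agree_Y_power_mult[of r s Q "T_fps ^ k * f"] fps_agree_sym fps_agree_trans by blast
qed

section \<open>Nullities of the powers\<close>

text \<open>Whether \<open>N ^ (k + Q)\<close> kills a series depends only on its
  coefficients at \<open>Y\<^sup>b\<close> with \<open>b < s\<close>, and for these the condition is that \<open>N ^ k\<close> of parameter \<open>s\<close> kills
  them; the \<open>r Q\<close> coefficients with \<open>s \<le> b\<close> are free. Because of the reversal of indices, the
  constrained coordinates \<open>(x, y)\<close> are those with \<open>Q \<le> y\<close>; the permutation \<open>\<pi>\<close> of the proof puts them
  first.\<close>

lemma kernel_dim_kron_nilp_shift: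
  assumes p: "prime CHAR('a :: field)" and Q: "Q = CHAR('a) ^ n" and r: "r \<le> Q"
  shows "kernel_dim (kron_nilp r (s + Q) ^\<^sub>m (k + Q) :: 'a mat) =
    kernel_dim (kron_nilp r s ^\<^sub>m k :: 'a mat) + r * Q"
proof (rule kernel_dim_reindex[where n = "r * s"])
  have size: "r * (s + Q) = r * s + r * Q" by (simp add: distrib_left)
  show "kron_nilp r (s + Q) ^\<^sub>m (k + Q) \<in> carrier_mat (r * s + r * Q) (r * s + r * Q)"
    using pow_carrier_mat[OF kron_nilp_carrier[of r "s + Q"]] by (simp add: size)
  show "kron_nilp r s ^\<^sub>m k \<in> carrier_mat (r * s) (r * s)"
    by (rule pow_carrier_mat[OF kron_nilp_carrier])
  define \<pi> where "\<pi> i = (if i < r * s then i div s * (s + Q) + (Q + i mod s)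
    else (i - r * s) div Q * (s + Q) + (i - r * s) mod Q)" for i
  \<comment> \<open>The inverse of \<open>\<pi>\<close>.\<close>
  define \<sigma> where "\<sigma> j = (if j mod (s + Q) < Q then r * s + (j div (s + Q) * Q + j mod (s + Q))
    else j div (s + Q) * s + (j mod (s + Q) - Q))" for j
  have \<pi>1: "\<pi> (x * s + y) = x * (s + Q) + (Q + y)" if "x < r" "y < s" for x y
    using that pair_index_less[OF that] by (simp add: \<pi>_def)
  have \<pi>2: "\<pi> (r * s + (x * Q + y)) = x * (s + Q) + y" if "x < r" "y < Q" for x y
    using that by (simp add: \<pi>_def)
  have \<sigma>1: "\<sigma> (x * (s + Q) + (Q + y)) = x * s + y" if "x < r" "y < s" for x y
  proof -
    have "(x * (s + Q) + (Q + y)) div (s + Q) = x" "(x * (s + Q) + (Q + y)) mod (s + Q) = Q + y"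
      using that by (simp_all del: add_mult_distrib2)
    then show ?thesis by (simp add: \<sigma>_def)
  qed
  have \<sigma>2: "\<sigma> (x * (s + Q) + y) = r * s + (x * Q + y)" if "x < r" "y < Q" for x y
  proof -
    have "(x * (s + Q) + y) div (s + Q) = x" "(x * (s + Q) + y) mod (s + Q) = y"
      using that by (simp_all del: add_mult_distrib2)
    then show ?thesis using that by (simp add: \<sigma>_def)
  qed
  have split1: thesis if "i < r * s + r * Q"
    "\<And>x y. i = x * s + y \<Longrightarrow> x < r \<Longrightarrow> y < s \<Longrightarrow> thesis"
    "\<And>x y. i = r * s + (x * Q + y) \<Longrightarrow> x < r \<Longrightarrow> y < Q \<Longrightarrow> thesis" for i thesis
  proof (cases "i < r * s")
    case True
    then have "s > 0" by (cases s) auto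
    then show ?thesis using that(2)[of "i div s" "i mod s"] True by (simp add: less_mult_imp_div_less)
  next
    case False
    then have j: "i - r * s < r * Q" using that(1) by auto
    then have "Q > 0" by (cases Q) auto
    then show ?thesis using that(3)[of "(i - r * s) div Q" "(i - r * s) mod Q"] False j
      by (simp add: less_mult_imp_div_less)
  qed
  have split2: thesis if "j < r * s + r * Q"
    "\<And>x y. j = x * (s + Q) + (Q + y) \<Longrightarrow> x < r \<Longrightarrow> y < s \<Longrightarrow> thesis"
    "\<And>x y. j = x * (s + Q) + y \<Longrightarrow> x < r \<Longrightarrow> y < Q \<Longrightarrow> thesis" for j thesis
  proof -
    define x y where "x = j div (s + Q)" and "y = j mod (s + Q)"
    have "s + Q > 0" using that(1) by (cases "s + Q") auto
    then have "y < s + Q" "x < r"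
      using that(1) unfolding x_def y_def size[symmetric] by (simp_all add: less_mult_imp_div_less)
    moreover have "j = x * (s + Q) + y" unfolding x_def y_def by (simp only: div_mult_mod_eq)
    ultimately show thesis
      using that(2)[of x "y - Q"] that(3)[of x y] by (cases "y < Q") auto
  qed
  show "bij_betw \<pi> {..<r * s + r * Q} {..<r * s + r * Q}"
  proof (rule bij_betw_byWitness[of _ \<sigma>])
    show "\<forall>i\<in>{..<r * s + r * Q}. \<sigma> (\<pi> i) = i"
    proof
      fix i assume "i \<in> {..<r * s + r * Q}"
      then have "i < r * s + r * Q" by simp
      then show "\<sigma> (\<pi> i) = i" by (rule split1) (simp_all only: \<pi>1 \<pi>2 \<sigma>1 \<sigma>2)
    qed
    show "\<forall>i\<in>{..<r * s + r * Q}. \<pi> (\<sigma> i) = i"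
    proof
      fix i assume "i \<in> {..<r * s + r * Q}"
      then have "i < r * s + r * Q" by simp
      then show "\<pi> (\<sigma> i) = i" by (rule split2) (simp_all only: \<pi>1 \<pi>2 \<sigma>1 \<sigma>2)
    qed
    show "\<pi> ` {..<r * s + r * Q} \<subseteq> {..<r * s + r * Q}"
    proof (rule image_subsetI)
      fix i assume "i \<in> {..<r * s + r * Q}"
      then have "i < r * s + r * Q" by simp
      then have "\<pi> i < r * (s + Q)"
        by (rule split1) (simp_all only: \<pi>1 \<pi>2, auto intro!: pair_index_less simp del: add_mult_distrib2)
      then show "\<pi> i \<in> {..<r * s + r * Q}" by (simp add: size)
    qed
    show "\<sigma> ` {..<r * s + r * Q} \<subseteq> {..<r * s + r * Q}"
    proof (rule image_subsetI)
      fix i assume "i \<in> {..<r * s + r * Q}"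
      then have "i < r * s + r * Q" by simp
      then have "\<sigma> i < r * s + r * Q"
        by (rule split2) (simp_all only: \<sigma>1 \<sigma>2, auto intro: pair_index_less trans_less_add1)
      then show "\<sigma> i \<in> {..<r * s + r * Q}" by simp
    qed
  qed
  fix v :: "'a vec" assume "v \<in> carrier_vec (r * s + r * Q)"
  then have v: "v \<in> carrier_vec (r * (s + Q))" by (simp add: size)
  let ?w = "vec (r * s) (\<lambda>i. v $ \<pi> i)"
  have "fps_agree r s (vec_fps r (s + Q) v) (vec_fps r s ?w)"
    unfolding fps_agree_def
  proof (intro allI impI)
    fix a b assume ab: "a < r" "b < s"
    define x y where "x = r - 1 - a" and "y = s - 1 - b"
    have xy: "x < r" "y < s" and "s + Q - 1 - b = Q + y" using ab by (auto simp: x_def y_def)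
    then have "coeff2 (vec_fps r (s + Q) v) a b = v $ (x * (s + Q) + (Q + y))"
      using ab by (simp only: vec_fps_nth x_def[symmetric]) simp
    also have "\<dots> = ?w $ (x * s + y)"
      using pair_index_less[OF xy] by (simp only: index_vec \<pi>1[OF xy])
    also have "\<dots> = coeff2 (vec_fps r s ?w) a b"
      using ab by (simp only: vec_fps_nth x_def y_def) simp
    finally show "coeff2 (vec_fps r (s + Q) v) a b = coeff2 (vec_fps r s ?w) a b" .
  qed
  then have "fps_agree r s (T_fps ^ k * vec_fps r (s + Q) v) 0 \<longleftrightarrow>
      fps_agree r s (T_fps ^ k * vec_fps r s ?w) 0"
    by (meson fps_agree_mult fps_agree_sym fps_agree_trans)
  then show "kron_nilp r (s + Q) ^\<^sub>m (k + Q) *\<^sub>v v = 0\<^sub>v (r * s + r * Q) \<longleftrightarrow>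
      kron_nilp r s ^\<^sub>m k *\<^sub>v ?w = 0\<^sub>v (r * s)"
    using kron_nilp_pow_mult_eq_0_iff[OF v, of "k + Q"] kron_nilp_pow_mult_eq_0_iff[of ?w r s k]
      T_fps_power_mult_agree_0_iff[OF p Q r, of s k "vec_fps r (s + Q) v"]
    by (simp add: size)
qed

text \<open>The coefficient of \<open>X\<^sup>m\<close> in \<open>U\<^sup>j\<close>, where \<open>U = - X / (1 + X)\<close> solves \<open>X + U + X U = 0\<close>. Such
  a solution is needed because \<open>M\<^sub>s\<close> modulo \<open>T\<close> is \<open>F[X] / (X\<^sup>r)\<close> with \<open>Y\<close> acting as \<open>U\<close>; dually, these
  coefficients give the kernel of \<open>N\<close>.\<close>

fun ker_coeff :: "nat \<Rightarrow> nat \<Rightarrow> 'a :: field" where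
  "ker_coeff 0 j = (if j = 0 then 1 else 0)"
| "ker_coeff (Suc m) 0 = 0"
| "ker_coeff (Suc m) (Suc j) = - (ker_coeff m j + ker_coeff m (Suc j))"

lemma ker_coeff_eq_0: "m < j \<Longrightarrow> ker_coeff m j = 0"
proof (induction m arbitrary: j)
  case (Suc m)
  then show ?case by (cases j) auto
qed auto

lemma kron_nilp_mat_kernel_iff:
  fixes v :: "'a :: field vec"
  assumes v: "v \<in> carrier_vec (r * s)"
  shows "v \<in> mat_kernel (kron_nilp r s) \<longleftrightarrow> (\<forall>x<r. \<forall>y<s.
    (if Suc x < r then v $ (Suc x * s + y) else 0) +
    (if Suc y < s then v $ (x * s + Suc y) else 0) +
    (if Suc x < r \<and> Suc y < s then v $ (Suc x * s + Suc y) else 0) = 0)"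
    (is "_ \<longleftrightarrow> (\<forall>x<r. \<forall>y<s. ?S x y = 0)")
proof -
  have "v \<in> mat_kernel (kron_nilp r s) \<longleftrightarrow> kron_nilp r s *\<^sub>v v = 0\<^sub>v (r * s)"
    using v by (simp add: mat_kernel[OF kron_nilp_carrier])
  also have "\<dots> \<longleftrightarrow> (\<forall>x<r. \<forall>y<s. ?S x y = 0)"
  proof
    assume "kron_nilp r s *\<^sub>v v = 0\<^sub>v (r * s)"
    then show "\<forall>x<r. \<forall>y<s. ?S x y = 0"
      unfolding kron_nilp_mult_vec[OF v, symmetric]
      by (metis kron_nilp_mult_vec[OF v] index_zero_vec(1) pair_index_less)
  next
    assume *: "\<forall>x<r. \<forall>y<s. ?S x y = 0"
    show "kron_nilp r s *\<^sub>v v = 0\<^sub>v (r * s)"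
    proof (rule eq_vecI)
      fix i assume "i < dim_vec (0\<^sub>v (r * s) :: 'a vec)"
      then have i: "i < r * s" by simp
      then have "s > 0" by (cases s) auto
      then have xy: "i div s < r" "i mod s < s" using i by (auto simp: less_mult_imp_div_less)
      have "(kron_nilp r s *\<^sub>v v) $ (i div s * s + i mod s) = 0"
        unfolding kron_nilp_mult_vec[OF v xy] using * xy by blast
      then show "(kron_nilp r s *\<^sub>v v) $ i = 0\<^sub>v (r * s) $ i" using i by simp
    qed (simp add: carrier_matD[OF kron_nilp_carrier])
  qed
  finally show ?thesis .
qed

text \<open>A vector of the kernel is determined by its coordinates \<open>(x, 0)\<close>: the equation of the row
  \<open>(x, y)\<close> expresses the coordinate \<open>(x, y + 1)\<close> by \<open>(x + 1, y)\<close> and \<open>(x + 1, y + 1)\<close>. Conversely,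
  prescribed values at \<open>(x, 0)\<close> extend by means of \<open>ker_coeff\<close>; that the extension vanishes at
  \<open>y = s\<close>, as the last row of equations requires, is where \<open>r \<le> s\<close> enters.\<close>

lemma kernel_dim_kron_nilp:
  assumes rs: "r \<le> s"
  shows "kernel_dim (kron_nilp r s :: 'a :: field mat) = r"
proof -
  let ?N = "kron_nilp r s :: 'a mat" and ?Z = "0\<^sub>m 0 r :: 'a mat"
  define f where "f v = vec r (\<lambda>x. v $ (x * s))" for v :: "'a vec"
  have idx0: "x * s < r * s" if "x < r" for x using that rs by auto
  have sub: "mat_kernel ?N \<subseteq> carrier_vec (r * s)"
    by (rule mat_kernel_carrier[OF kron_nilp_carrier])
  have kerZ: "mat_kernel ?Z = carrier_vec r"
    by (auto simp: mat_kernel[of _ 0 r])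
  have "inj_on f (mat_kernel ?N)"
  proof (rule inj_onI)
    fix u v assume uv: "u \<in> mat_kernel ?N" "v \<in> mat_kernel ?N" and eq: "f u = f v"
    then have carr: "u \<in> carrier_vec (r * s)" "v \<in> carrier_vec (r * s)" using sub by auto
    have "\<forall>x<r. u $ (x * s + y) = v $ (x * s + y)" if "y < s" for y
      using that
    proof (induction y)
      case 0
      show ?case
      proof (intro allI impI)
        fix x assume "x < r"
        then show "u $ (x * s + 0) = v $ (x * s + 0)"
          using arg_cong[OF eq, of "\<lambda>w. w $ x"] by (simp add: f_def)
      qed
    next
      case (Suc y)
      show ?case
      proof (intro allI impI)
        fix x assume "x < r"
        then show "u $ (x * s + Suc y) = v $ (x * s + Suc y)"
        proof (induction "r - x" arbitrary: x rule: less_induct)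
          case less
          have rel: "(if Suc x < r then w $ (Suc x * s + y) else 0) + w $ (x * s + Suc y) +
            (if Suc x < r then w $ (Suc x * s + Suc y) else 0) = 0"
            if "w \<in> mat_kernel ?N" "w \<in> carrier_vec (r * s)" for w
            using iffD1[OF kron_nilp_mat_kernel_iff[OF that(2)] that(1), rule_format, of x y]
              less.prems Suc.prems by auto
          show ?case
          proof (cases "Suc x < r")
            case True
            then have "u $ (Suc x * s + y) = v $ (Suc x * s + y)"
              "u $ (Suc x * s + Suc y) = v $ (Suc x * s + Suc y)"
              using Suc less.hyps[of "Suc x"] by auto
            then show ?thesis
              using rel[OF uv(1) carr(1)] rel[OF uv(2) carr(2)] True
              by (simp only: if_True) (metis add.commute add_left_imp_eq)
          next
            case False
            then show ?thesis
              using rel[OF uv(1) carr(1)] rel[OF uv(2) carr(2)] by simp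
          qed
        qed
      qed
    qed
    then have "u $ i = v $ i" if "i < r * s" for i
    proof -
      have "s > 0" using that by (cases s) auto
      then have "i div s < r" "i mod s < s" using that by (auto simp: less_mult_imp_div_less)
      then show ?thesis using \<open>\<And>y. y < s \<Longrightarrow> _ y\<close>[of "i mod s"] by (metis div_mult_mod_eq)
    qed
    then show "u = v" using carr by (intro eq_vecI) auto
  qed
  moreover have "f ` mat_kernel ?N = carrier_vec r"
  proof (intro equalityI subsetI)
    fix w :: "'a vec" assume w: "w \<in> carrier_vec r"
    define h where "h x y = (\<Sum>i<r. w $ i * (if x \<le> i then ker_coeff (i - x) y else 0))" for x y
    define v where "v = vec (r * s) (\<lambda>j. h (j div s) (j mod s))"
    have v: "v $ (x * s + y) = h x y" if "x < r" "y < s" for x y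
      using that pair_index_less[OF that] by (simp add: v_def)
    have carr: "v \<in> carrier_vec (r * s)" by (simp add: v_def)
    have h_r: "h x y = 0" if "r \<le> x" for x y
      using that by (simp add: h_def)
    have h_s: "h x y = 0" if "s \<le> y" for x y
    proof -
      have "i - x < y" if "i < r" for i using that rs \<open>s \<le> y\<close> by auto
      then show ?thesis by (auto simp: h_def ker_coeff_eq_0 intro!: sum.neutral)
    qed
    \<comment> \<open>The relation \<open>X + U + X U = 0\<close>, multiplied by \<open>U\<^sup>y\<close> and read off coefficientwise.\<close>
    have rel: "h (Suc x) y + h x (Suc y) + h (Suc x) (Suc y) = 0" for x y
    proof -
      have "(if Suc x \<le> i then ker_coeff (i - Suc x) y else 0) +
        (if x \<le> i then ker_coeff (i - x) (Suc y) else 0) +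
        (if Suc x \<le> i then ker_coeff (i - Suc x) (Suc y) else 0) = (0 :: 'a)" for i
      proof (cases "Suc x \<le> i")
        case True
        then have "i - x = Suc (i - Suc x)" by simp
        then show ?thesis using True by simp
      qed (cases "x = i"; simp)
      then show ?thesis
        unfolding h_def sum.distrib[symmetric] distrib_left[symmetric] by simp
    qed
    have "v \<in> mat_kernel ?N"
      unfolding kron_nilp_mat_kernel_iff[OF carr]
    proof (intro allI impI)
      fix x y assume "x < r" "y < s"
      then show "(if Suc x < r then v $ (Suc x * s + y) else 0) +
        (if Suc y < s then v $ (x * s + Suc y) else 0) +
        (if Suc x < r \<and> Suc y < s then v $ (Suc x * s + Suc y) else 0) = 0"
        using rel[of x y] h_r[of "Suc x"] h_s[of "Suc y"] v[of "Suc x" y] v[of x "Suc y"] v[of "Suc x" "Suc y"]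
        by (simp only: not_less split: if_split) auto
    qed
    moreover have "f v = w"
    proof (rule eq_vecI)
      fix x assume "x < dim_vec w"
      then have x: "x < r" using w by simp
      have "h x 0 = (\<Sum>i<r. if i = x then w $ i else 0)"
        unfolding h_def
      proof (intro sum.cong refl)
        fix i show "w $ i * (if x \<le> i then ker_coeff (i - x) 0 else 0) = (if i = x then w $ i else 0)"
          by (cases "i - x") auto
      qed
      then show "f v $ x = w $ x" using x v[of x 0] rs by (simp add: f_def)
    qed (use w in \<open>simp add: f_def\<close>)
    ultimately show "w \<in> f ` mat_kernel ?N" by blast
  qed (auto simp: f_def)
  ultimately have "bij_betw f (mat_kernel ?N) (mat_kernel ?Z)"
    by (simp add: bij_betw_def kerZ)
  then have "kernel_dim ?N = kernel_dim ?Z"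
    by (rule kernel_dim_eqI[OF kron_nilp_carrier zero_carrier_mat])
      (auto simp: f_def idx0 simp del: mult_less_cancel2 intro!: eq_vecI)
  then show ?thesis by (simp add: kernel_dim_zero_mat)
qed

text \<open>Setting \<open>Y = 0\<close> turns \<open>T\<close> into \<open>X\<close>.\<close>

lemma coeff2_T_fps_power: "coeff2 (T_fps ^ k) a 0 = (if a = k then 1 else 0)"
  by (induction k arbitrary: a) (auto simp: T_fps_mult_nth power_Suc)

text \<open>\<open>N ^ k\<close> is not zero, because it maps the vector of the series \<open>1\<close> to that of \<open>T ^ k\<close>, in which
  the monomial \<open>X\<^sup>k\<close> occurs.\<close>

lemma kernel_dim_kron_nilp_pow_neq:
  assumes "k < r" "0 < s"
  shows "kernel_dim (kron_nilp r s ^\<^sub>m k :: 'a :: field mat) \<noteq> r * s"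
proof
  let ?A = "kron_nilp r s ^\<^sub>m k :: 'a mat"
  assume "kernel_dim ?A = r * s"
  then have ker: "mat_kernel ?A = carrier_vec (r * s)"
    by (rule mat_kernel_eq_carrier_vec[OF pow_carrier_mat[OF kron_nilp_carrier]])
  \<comment> \<open>The last unit vector has the series \<open>1\<close>, as \<open>vec_fps\<close> reverses the indices.\<close>
  define v :: "'a vec" where "v = unit_vec (r * s) (r * s - 1)"
  have v: "v \<in> carrier_vec (r * s)" by (simp add: v_def)
  have "vec_fps r s v = 1"
  proof (intro fps_ext)
    fix a b
    show "coeff2 (vec_fps r s v) a b = coeff2 1 a b"
    proof (cases "a < r \<and> b < s")
      case True
      then obtain x y where rs: "r = Suc (a + x)" "s = Suc (b + y)"
        by (auto dest!: less_imp_Suc_add)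
      have "x * s + y < r * s" by (rule pair_index_less) (simp_all add: rs)
      moreover have "x * s + y = r * s - 1 \<longleftrightarrow> a = 0 \<and> b = 0"
        by (auto simp: rs algebra_simps)
      ultimately show ?thesis using True
        by (auto simp: vec_fps_nth v_def rs unit_vec_def)
    next
      case False
      then show ?thesis using assms by (auto simp: vec_fps_nth)
    qed
  qed
  moreover have "?A *\<^sub>v v = 0\<^sub>v (r * s)"
    using ker v by (auto simp: mat_kernel[OF pow_carrier_mat[OF kron_nilp_carrier]])
  ultimately have "fps_agree r s (T_fps ^ k :: 'a fps fps) 0"
    using kron_nilp_pow_mult_eq_0_iff[OF v, of k] by simp
  then have "coeff2 (T_fps ^ k :: 'a fps fps) k 0 = 0" using assms by (simp add: fps_agree_def)
  then show False by (simp add: coeff2_T_fps_power)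
qed

section \<open>Lists determined by truncated sums\<close>

text \<open>The nullity of the \<open>k\<close>-th power of a nilpotent matrix with Jordan blocks of the sizes \<open>l\<close>.\<close>

definition min_sum :: "nat \<Rightarrow> nat list \<Rightarrow> nat" where
  "min_sum k l = (\<Sum>x\<leftarrow>l. min k x)"

lemma min_sum_1: "0 \<notin> set l \<Longrightarrow> min_sum 1 l = length l"
  unfolding min_sum_def by (induction l) (auto simp: min_def)

lemma min_sum_le: "min_sum k l \<le> k * length l"
  unfolding min_sum_def by (induction l) auto

lemma min_sum_eq_mult_length_iff: "min_sum k l = k * length l \<longleftrightarrow> (\<forall>x\<in>set l. k \<le> x)"
proof (induction l)
  case (Cons a l)
  then show ?case using min_sum_le[of k l] by (auto simp: min_sum_def min_def)
qed (simp add: min_sum_def)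

lemma min_sum_map_add: "min_sum (k + Q) (map (\<lambda>x. x + Q) l) = min_sum k l + Q * length l"
  unfolding min_sum_def by (induction l) (auto simp: min_def)

lemma min_sum_Suc: "min_sum (Suc k) l = min_sum k l + length (filter (\<lambda>x. k < x) l)"
  unfolding min_sum_def by (induction l) auto

text \<open>The increments of \<open>min_sum\<close> in \<open>k\<close> count the entries greater than \<open>k\<close>, and the increments of
  these counts give the number of occurrences of each positive entry. Zeros are invisible to
  \<open>min_sum\<close>; they are recovered from the length.\<close>

lemma mset_eq_if_min_sum_eq:
  assumes "\<And>k. min_sum k l = min_sum k l'" and "length l = length l'"
  shows "mset l = mset l'"
proof (rule multiset_eqI)
  fix x
  have gt: "length (filter (\<lambda>y. k < y) l) = length (filter (\<lambda>y. k < y) l')" for k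
    using min_sum_Suc[of k l] min_sum_Suc[of k l'] assms(1) by simp
  show "count (mset l) x = count (mset l') x"
  proof (cases x)
    case 0
    have "count (mset xs) 0 + length (filter (\<lambda>y. 0 < y) xs) = length xs" for xs :: "nat list"
      by (induction xs) auto
    then show ?thesis using 0 gt[of 0] assms(2) by (metis add_right_cancel)
  next
    case (Suc k)
    have "count (mset xs) (Suc k) + length (filter (\<lambda>y. Suc k < y) xs) = length (filter (\<lambda>y. k < y) xs)"
      for xs by (induction xs) auto
    then show ?thesis using Suc gt[of k] gt[of "Suc k"] by (metis add_right_cancel)
  qed
qed

section \<open>Block sizes for s and for s plus a power of p\<close>

lemma min_sum_jordan_partition:
  assumes "is_jordan_partition TYPE('a :: field) r s l"
  shows "min_sum k l = kernel_dim (kron_nilp r s ^\<^sub>m k :: 'a mat)"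
proof -
  have "jordan_nf (kron_jordan r s :: 'a mat) (map (\<lambda>m. (m, 1)) l)"
    using assms by (simp add: is_jordan_partition_def)
  from dim_gen_eigenspace[OF this, of 1 k]
  have "kernel_dim (kron_nilp r s ^\<^sub>m k :: 'a mat) =
      (\<Sum>x\<leftarrow>map fst (filter (\<lambda>(n, e). e = 1) (map (\<lambda>m. (m, 1 :: 'a)) l)). min k x)"
    by (simp add: dim_gen_eigenspace_def kron_nilp_def)
  also have "map fst (filter (\<lambda>(n, e). e = 1) (map (\<lambda>m. (m, 1 :: 'a)) l)) = l"
    by (induction l) auto
  finally show ?thesis by (simp add: min_sum_def)
qed

lemma is_jordan_partition_jordan_partition: "is_jordan_partition TYPE('a :: field) r s (jordan_partition TYPE('a) r s)"
  unfolding jordan_partition_def by (rule theI'[OF is_jordan_partition_ex1])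

lemma jordan_partition_pos: "is_jordan_partition TYPE('a :: field) r s l \<Longrightarrow> 0 \<notin> set l"
  by (force simp: is_jordan_partition_def jordan_nf_def)

lemma jordan_partition_sorted: "is_jordan_partition TYPE('a :: field) r s l \<Longrightarrow> sorted (rev l)"
  by (simp add: is_jordan_partition_def sorted_wrt_rev)

lemma sum_list_jordan_partition:
  assumes "is_jordan_partition TYPE('a :: field) r s l"
  shows "sum_list l = r * s"
proof -
  let ?K = "kron_jordan r s :: 'a mat" and ?J = "jordan_matrix (map (\<lambda>m. (m, 1 :: 'a)) l)"
  have "similar_mat ?K ?J"
    using assms by (simp add: is_jordan_partition_def jordan_nf_def)
  from similar_matD[OF this] obtain n P Q where "{?K, ?J, P, Q} \<subseteq> carrier_mat n n" by blast
  then have "?K \<in> carrier_mat n n" "?J \<in> carrier_mat n n" by blast+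
  then have "dim_row ?K = n" "dim_row ?J = n" by (simp_all only: carrier_matD)
  then show ?thesis by (simp add: kronecker_mat_def comp_def)
qed

lemma length_jordan_partition:
  assumes "is_jordan_partition TYPE('a :: field) r s l" "r \<le> s"
  shows "length l = r"
  using min_sum_1[OF jordan_partition_pos[OF assms(1)]] min_sum_jordan_partition[OF assms(1), of 1]
    kernel_dim_kron_nilp[OF assms(2), where ?'a = 'a] by simp

text \<open>The nullity of \<open>N ^ Q\<close> is \<open>r Q\<close>, the largest value that \<open>r\<close> blocks allow; so no block is
  shorter than \<open>Q\<close>.\<close>

lemma jordan_partition_ge:
  assumes p: "prime CHAR('a :: field)" and Q: "Q = CHAR('a) ^ n" and r: "r \<le> Q"
    and l: "is_jordan_partition TYPE('a) r s l" and s: "Q \<le> s" and x: "x \<in> set l"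
  shows "Q \<le> x"
proof -
  have "min_sum Q l = r * Q"
    using kernel_dim_kron_nilp_shift[OF p Q r, of "s - Q" 0] min_sum_jordan_partition[OF l, of Q] s
      kernel_one_mat(1)[of "r * (s - Q)", where ?'a = 'a]
    by (simp add: kernel_dim_def carrier_matD[OF kron_nilp_carrier])
  then have "min_sum Q l = Q * length l"
    using length_jordan_partition[OF l] r s by simp
  then show ?thesis using x by (simp add: min_sum_eq_mult_length_iff)
qed

text \<open>Both lists have \<open>r\<close> entries, so it is enough to compare the truncated sums. From \<open>Q\<close> on this
  is the shift of the nullities; below \<open>Q\<close> both sums are \<open>k r\<close>, since all entries are at least \<open>Q\<close>.\<close>

lemma jordan_partition_shift:
  assumes p: "prime CHAR('a :: field)" and Q: "Q = CHAR('a) ^ n" and r: "r \<le> Q" and s: "r \<le> s"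
  shows "jordan_partition TYPE('a) r (s + Q) = map (\<lambda>x. x + Q) (jordan_partition TYPE('a) r s)"
proof -
  define l l' where "l = jordan_partition TYPE('a) r s" and "l' = jordan_partition TYPE('a) r (s + Q)"
  have l: "is_jordan_partition TYPE('a) r s l" and l': "is_jordan_partition TYPE('a) r (s + Q) l'"
    unfolding l_def l'_def by (rule is_jordan_partition_jordan_partition)+
  have len: "length l = r" "length l' = r"
    using length_jordan_partition[OF l s] length_jordan_partition[OF l'] s by simp_all
  have "mset l' = mset (map (\<lambda>x. x + Q) l)"
  proof (rule mset_eq_if_min_sum_eq)
    fix k
    show "min_sum k l' = min_sum k (map (\<lambda>x. x + Q) l)"
    proof (cases "Q \<le> k")
      case True
      then obtain j where k: "k = j + Q" by (metis le_add_diff_inverse2)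
      show ?thesis
        using kernel_dim_kron_nilp_shift[OF p Q r, of s j] len
        by (simp add: k min_sum_jordan_partition[OF l'] min_sum_jordan_partition[OF l, symmetric]
            min_sum_map_add)
    next
      case False
      have "\<forall>x\<in>set l'. Q \<le> x" using jordan_partition_ge[OF p Q r l'] by simp
      then have "min_sum k l' = k * length l'"
        using False by (subst min_sum_eq_mult_length_iff) auto
      moreover have "min_sum k (map (\<lambda>x. x + Q) l) = k * length (map (\<lambda>x. x + Q) l)"
        using False by (subst min_sum_eq_mult_length_iff) auto
      ultimately show ?thesis by (simp add: len)
    qed
  qed (simp add: len)
  then have "mset (rev l') = mset (rev (map (\<lambda>x. x + Q) l))" by simp
  moreover have "sorted (rev (map (\<lambda>x. x + Q) l))"
    using jordan_partition_sorted[OF l] by (simp add: rev_map sorted_map sorted_wrt_mono_rel)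
  ultimately have "rev l' = rev (map (\<lambda>x. x + Q) l)"
    using jordan_partition_sorted[OF l'] by (metis properties_for_sort)
  then show ?thesis unfolding l_def l'_def by (simp only: rev_is_rev_conv)
qed

text \<open>All \<open>r\<close> blocks have at least the size \<open>Q\<close>, and the sizes add up to \<open>r Q\<close>.\<close>

lemma jordan_partition_prime_power:
  assumes p: "prime CHAR('a :: field)" and Q: "Q = CHAR('a) ^ n" and r: "r \<le> Q"
  shows "jordan_partition TYPE('a) r Q = replicate r Q"
proof -
  define l where "l = jordan_partition TYPE('a) r Q"
  have l: "is_jordan_partition TYPE('a) r Q l" unfolding l_def by (rule is_jordan_partition_jordan_partition)
  have len: "length l = r" using length_jordan_partition[OF l r] .
  have ge: "\<forall>x\<in>set l. Q \<le> x" using jordan_partition_ge[OF p Q r l] by simp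
  have le: "\<forall>x\<in>set l. x \<le> Q"
  proof (rule ccontr)
    assume "\<not> ?thesis"
    then obtain x where x: "x \<in> set l" "Q < x" by auto
    have "sum_list l = min_sum Q l + (\<Sum>y\<leftarrow>l. y - Q)"
      unfolding min_sum_def by (induction l) auto
    moreover have "min_sum Q l = Q * length l" using ge by (simp add: min_sum_eq_mult_length_iff)
    ultimately have "(\<Sum>y\<leftarrow>l. y - Q) = 0"
      using sum_list_jordan_partition[OF l] len by simp
    then show False using x by auto
  qed
  have "\<forall>x\<in>set l. x = Q" using ge le by (auto intro: le_antisym)
  then have "l = replicate r Q" using len by - (rule replicate_eqI, auto)
  then show ?thesis by (simp only: l_def)
qed

section \<open>Compositions and their least period\<close>

definition multiplicities :: "nat list \<Rightarrow> nat list" where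
  "multiplicities l = map (count_list l) (rev (sorted_list_of_set (set l)))"

lemma multiplicities_map_add: "multiplicities (map (\<lambda>x. x + Q) l) = multiplicities l"
proof -
  have "sorted_list_of_set (set (map (\<lambda>x. x + Q) l)) = map (\<lambda>x. x + Q) (sorted_list_of_set (set l))"
    by (intro sorted_distinct_set_unique) (auto simp: sorted_map distinct_map inj_on_def intro: sorted_wrt_mono_rel[OF _ sorted_sorted_list_of_set])
  moreover have "count_list (map (\<lambda>x. x + Q) l) (x + Q) = count_list l x" for x
    by (induction l) auto
  ultimately show ?thesis by (simp add: multiplicities_def rev_map)
qed

lemma multiplicities_replicate:
  assumes "r > 0"
  shows "multiplicities (replicate r x) = [r]"
proof -
  have "count_list (replicate r x) x = r" by (induction r) auto
  then show ?thesis using assms by (simp add: multiplicities_def)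
qed

lemma multiplicities_eq_singletonD:
  assumes "multiplicities l = [m]"
  obtains x where "l = replicate (length l) x"
proof -
  have "length (sorted_list_of_set (set l)) = 1"
    using arg_cong[OF assms, of length] by (simp add: multiplicities_def)
  then obtain x where "set l = {x}" by (auto simp: card_1_singleton_iff)
  then have "l = replicate (length l) x" by - (rule replicate_eqI, auto)
  then show thesis by (rule that)
qed

lemma jordan_composition_eq: "jordan_composition TYPE('a :: field) r s = multiplicities (jordan_partition TYPE('a) r s)"
  by (simp add: jordan_composition_def multiplicities_def Let_def)

lemma jordan_composition_period:
  assumes "prime CHAR('a :: field)" "Q = CHAR('a) ^ n" "r \<le> Q" "r \<le> s"
  shows "jordan_composition TYPE('a) r (s + Q) = jordan_composition TYPE('a) r s"
  unfolding jordan_composition_eq jordan_partition_shift[OF assms] by (rule multiplicities_map_add)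

text \<open>Equality would force \<open>r\<close> blocks of equal size \<open>Q + q\<close>, so \<open>N ^ (Q + q)\<close> would vanish; by the
  shift of the nullities \<open>N ^ q\<close> of parameter \<open>q\<close> would then vanish as well.\<close>

lemma jordan_composition_not_period:
  assumes p: "prime CHAR('a :: field)" and Q: "Q = CHAR('a) ^ n" and r: "r \<le> Q"
    and q: "0 < q" "q < r"
  shows "jordan_composition TYPE('a) r (Q + q) \<noteq> jordan_composition TYPE('a) r Q"
proof
  assume eq: "jordan_composition TYPE('a) r (Q + q) = jordan_composition TYPE('a) r Q"
  define l where "l = jordan_partition TYPE('a) r (Q + q)"
  have l: "is_jordan_partition TYPE('a) r (Q + q) l" unfolding l_def by (rule is_jordan_partition_jordan_partition)
  have len: "length l = r" using length_jordan_partition[OF l] r by simp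
  have "multiplicities l = [r]"
    using eq q by (simp add: jordan_composition_eq l_def jordan_partition_prime_power[OF p Q r]
        multiplicities_replicate)
  then obtain x where x: "l = replicate r x"
    by (rule multiplicities_eq_singletonD) (simp only: len)
  then have "x = Q + q" using sum_list_jordan_partition[OF l] q by (simp add: sum_list_replicate)
  then have "min_sum (q + Q) l = r * (q + Q)"
    using x by (simp add: min_sum_def sum_list_replicate add.commute)
  then have "kernel_dim (kron_nilp r (q + Q) ^\<^sub>m (q + Q) :: 'a mat) = r * (q + Q)"
    using min_sum_jordan_partition[OF l, of "q + Q"] by (simp add: add.commute)
  then have "kernel_dim (kron_nilp r q ^\<^sub>m q :: 'a mat) = r * q"
    unfolding kernel_dim_kron_nilp_shift[OF p Q r] by (simp add: distrib_left)
  then show False using kernel_dim_kron_nilp_pow_neq[OF q(2,1), where ?'a = 'a] by simp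
qed

text \<open>For a sequence that is purely periodic from \<open>r\<close> on, the Bezout identity
  \<open>P x = Q y + gcd P Q\<close> makes the greatest common divisor of two periods a period.\<close>

lemma period_gcd:
  fixes f :: "nat \<Rightarrow> 'b"
  assumes P: "\<And>s. r \<le> s \<Longrightarrow> f (s + P) = f s" and Q: "\<And>s. r \<le> s \<Longrightarrow> f (s + Q) = f s"
    and "P > 0" and s: "r \<le> s" and dvd: "gcd P Q dvd d"
  shows "f (s + d) = f s"
proof -
  have mult: "f (s + M * i) = f s" if "r \<le> s" "\<And>s. r \<le> s \<Longrightarrow> f (s + M) = f s" for M i s
  proof (induction i)
    case (Suc i)
    have "f (s + M * Suc i) = f ((s + M * i) + M)" by (simp add: algebra_simps)
    also have "\<dots> = f (s + M * i)" using that by simp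
    finally show ?case using Suc by simp
  qed simp
  obtain x y where xy: "P * x = Q * y + gcd P Q"
    using bezout_nat[of P Q] \<open>P > 0\<close> by auto
  have "f (s + gcd P Q) = f s" if "r \<le> s" for s
  proof -
    have "f (s + gcd P Q) = f (s + gcd P Q + Q * y)" using mult[of "s + gcd P Q" Q y] that Q by simp
    also have "\<dots> = f (s + P * x)" by (simp add: xy add_ac)
    also have "\<dots> = f s" using mult[OF that P] by blast
    finally show ?thesis .
  qed
  moreover obtain i where "d = gcd P Q * i" using dvd by (elim dvdE)
  ultimately show ?thesis using mult[OF s] by blast
qed

theorem theorem2:
  fixes p r n :: nat
  assumes "prime p"
    and "CHAR('a :: field) = p"
    and "r > 0"
    and "real p powi (int n - 1) < real r"
    and "r \<le> p ^ n"
  shows "(\<forall>s\<ge>r. jordan_composition TYPE('a) r (s + p ^ n) = jordan_composition TYPE('a) r s) \<and>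
    (\<forall>P. 0 < P \<and> P < p ^ n \<longrightarrow>
      \<not> (\<forall>s\<ge>r. jordan_composition TYPE('a) r (s + P) = jordan_composition TYPE('a) r s))"
proof -
  have p: "prime CHAR('a)" and Q: "p ^ n = CHAR('a) ^ n" using assms by auto
  have per: "jordan_composition TYPE('a) r (s + p ^ n) = jordan_composition TYPE('a) r s" if "r \<le> s" for s
    using jordan_composition_period[OF p Q assms(5) that] .
  have False if P: "0 < P" "P < p ^ n"
    and perP: "\<forall>s\<ge>r. jordan_composition TYPE('a) r (s + P) = jordan_composition TYPE('a) r s" for P
  proof -
    obtain m where n: "n = Suc m" using P by (cases n) auto
    have "real (p ^ m) < real r" using assms(4) by (simp add: n)
    then have m: "p ^ m < r" by (simp only: of_nat_less_iff)
    obtain i where i: "i \<le> n" "gcd P (p ^ n) = p ^ i"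
      using divides_primepow_nat[OF assms(1), of "gcd P (p ^ n)" n] by auto
    have "gcd P (p ^ n) \<le> P" using P by (intro gcd_le1_nat) simp
    then have "i \<noteq> n" using i P by auto
    then have dvd: "gcd P (p ^ n) dvd p ^ m" using i n by (simp add: le_imp_power_dvd)
    have "jordan_composition TYPE('a) r (p ^ n + p ^ m) = jordan_composition TYPE('a) r (p ^ n)"
    proof (rule period_gcd[of r _ P "p ^ n"])
      show "jordan_composition TYPE('a) r (s + P) = jordan_composition TYPE('a) r s" if "r \<le> s" for s
        using perP that by simp
      show "jordan_composition TYPE('a) r (s + p ^ n) = jordan_composition TYPE('a) r s" if "r \<le> s" for s
        using that by (rule per)
    qed (rule P(1) assms(5) dvd)+
    then show False
      using jordan_composition_not_period[OF p Q assms(5) _ m] prime_gt_0_nat[OF assms(1)] by simp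
  qed
  then show ?thesis using per by auto
qed

end
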